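(* Let $k,l$ be positive integers, and for $n\ge 0$ let $c^{k,l}(n)$ denote the number of compositions of $n$ that fit inside a $k\times l$ rectangle, i.e. the number of sequences $(\kappa_1,\ldots,\kappa_r)$ of positive integers with $r\le k$, each $\kappa_i\le l$, and $\sum_i\kappa_i=n$ (the empty composition, with $r=0$, is counted for $n=0$). Let $f^{k,l}(q)=\sum_{n\ge 0}c^{k,l}(n)q^n$ and $[l]=1+q+\cdots+q^{l-1}$. (a) If $k\ge 2$ then $f^{k,l}=1+q\,[l]\,f^{k-1,l}$. (b) The polynomial $f^{k,l}$ is unimodal; that is, the sequence $c^{k,l}(0),c^{k,l}(1),\ldots,c^{k,l}(kl)$ is unimodal.
   Context: A sequence $a_0,a_1,\ldots,a_r$ of nonnegative numbers is unimodal if there is an index $m$ with $a_0\le a_1\le\cdots\le a_m\ge a_{m+1}\ge\cdots\ge a_r$. A polynomial is called unimodal if its sequence of coefficients is. *)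

theory Defs
  imports "HOL-Computational_Algebra.Polynomial"
begin

definition rect_compositions :: "nat \<Rightarrow> nat \<Rightarrow> nat \<Rightarrow> nat list set" where
  "rect_compositions k l n =
     {\<kappa>. length \<kappa> \<le> k \<and> (\<forall>x\<in>set \<kappa>. 1 \<le> x \<and> x \<le> l) \<and> sum_list \<kappa> = n}"

definition comp_count :: "nat \<Rightarrow> nat \<Rightarrow> nat \<Rightarrow> nat" where
  "comp_count k l n = card (rect_compositions k l n)"

(* The sum over all n is cut off at k * l; the lemma coeff_comp_poly below shows that
   nothing is lost. *)
definition comp_poly :: "nat \<Rightarrow> nat \<Rightarrow> int poly" where
  "comp_poly k l = (\<Sum>n\<le>k * l. monom (int (comp_count k l n)) n)"

definition q_int :: "nat \<Rightarrow> int poly" where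
  "q_int l = (\<Sum>i<l. monom 1 i)"

(* Only the entries a 0, ..., a r of the sequence matter. *)
definition unimodal_upto :: "nat \<Rightarrow> (nat \<Rightarrow> 'a::{linorder, zero}) \<Rightarrow> bool" where
  "unimodal_upto r a \<longleftrightarrow>
     (\<forall>i\<le>r. 0 \<le> a i) \<and>
     (\<exists>m\<le>r. (\<forall>i<m. a i \<le> a (Suc i)) \<and> (\<forall>i. m \<le> i \<and> i < r \<longrightarrow> a (Suc i) \<le> a i))"

definition unimodal_poly :: "'a::{linorder, zero} poly \<Rightarrow> bool" where
  "unimodal_poly p \<longleftrightarrow> unimodal_upto (degree p) (coeff p)"

lemma finite_rect_compositions: "finite (rect_compositions k l n)"
proof (rule finite_subset)
  show "rect_compositions k l n \<subseteq> {\<kappa>. set \<kappa> \<subseteq> {1..l} \<and> length \<kappa> \<le> k}"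
    by (auto simp: rect_compositions_def)
qed (simp add: finite_lists_length_le)

lemma comp_count_eq_0:
  assumes "n > k * l"
  shows "comp_count k l n = 0"
proof -
  have bound: "(\<forall>x\<in>set xs. x \<le> l) \<Longrightarrow> sum_list xs \<le> length xs * l" for xs :: "nat list"
    by (induction xs) auto
  have "rect_compositions k l n = {}"
  proof (rule equals0I)
    fix \<kappa> assume k: "\<kappa> \<in> rect_compositions k l n"
    have "n \<le> length \<kappa> * l"
      using k bound[of \<kappa>] by (auto simp: rect_compositions_def)
    also have "\<dots> \<le> k * l"
      using k by (auto simp: rect_compositions_def)
    finally show False
      using assms by simp
  qed
  thus ?thesis
    by (simp add: comp_count_def)
qed

lemma coeff_comp_poly: "coeff (comp_poly k l) n = int (comp_count k l n)"
proof (cases "n \<le> k * l")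
  case True
  thus ?thesis
    by (simp add: comp_poly_def coeff_sum)
next
  case False
  thus ?thesis
    by (simp add: comp_poly_def coeff_sum comp_count_eq_0)
qed

end

(* Multiplying by [l] keeps a nonnegative unimodal sequence a unimodal: consecutive coefficients
   of the product differ by a (n+1) - a (n+1-l), and once this difference has become negative it
   stays nonpositive. Splitting off the first part of a composition gives f = 1 + q [l] f', and
   since [l] f' has constant coefficient 1, prepending another 1 preserves unimodality. *)
theory Submission
  imports Defs
begin

text \<open>The whole infinite sequence is used and the peak is unbounded, so products need no
  tracking of degrees; truncation at any \<open>r\<close> comes afterwards.\<close>

definition unimodal_seq :: "(nat \<Rightarrow> 'a::linorder) \<Rightarrow> bool" where
  "unimodal_seq a \<longleftrightarrow>
     (\<exists>m. (\<forall>i<m. a i \<le> a (Suc i)) \<and> (\<forall>i\<ge>m. a (Suc i) \<le> a i))"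

lemma unimodal_upto_of_unimodal_seq:
  assumes "unimodal_seq a" "\<And>i. 0 \<le> a i"
  shows "unimodal_upto r a"
proof -
  obtain m where m: "\<And>i. i < m \<Longrightarrow> a i \<le> a (Suc i)" "\<And>i. i \<ge> m \<Longrightarrow> a (Suc i) \<le> a i"
    using assms(1) unfolding unimodal_seq_def by blast
  \<comment> \<open>If the peak lies beyond \<open>r\<close>, the truncated sequence only rises and
    peaks at \<open>r\<close>; hence \<open>min m r\<close>.\<close>
  show ?thesis
    unfolding unimodal_upto_def using assms(2) m by (intro conjI exI[of _ "min m r"]) auto
qed

lemma unimodal_upto_of_nat:
  fixes a :: "nat \<Rightarrow> nat"
  shows "unimodal_upto r (\<lambda>i. int (a i)) \<longleftrightarrow> unimodal_upto r a"
  by (simp add: unimodal_upto_def)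

lemma coeff_q_int_mult:
  "coeff (q_int l * p) n = (\<Sum>i<l. if i \<le> n then coeff p (n - i) else 0)"
  by (auto simp: q_int_def sum_distrib_right coeff_sum coeff_monom_mult intro!: sum.cong)

text \<open>Each coefficient sums a window of \<open>l\<close> consecutive coefficients of
  \<open>p\<close>; sliding the window by one gains one entry and loses one.\<close>

lemma coeff_q_int_mult_Suc:
  "coeff (q_int l * p) (Suc n) =
     coeff (q_int l * p) n + coeff p (Suc n) - (if l \<le> Suc n then coeff p (Suc n - l) else 0)"
proof (induction l)
  case 0
  then show ?case by (simp add: coeff_q_int_mult)
next
  case (Suc l)
  then show ?case by (auto simp: coeff_q_int_mult)
qed

lemma unimodal_q_int_mult:
  assumes nonneg: "\<And>i. 0 \<le> coeff p i" and uni: "unimodal_seq (coeff p)"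
  shows "unimodal_seq (coeff (q_int l * p))"
proof -
  define b where "b = coeff (q_int l * p)"
  \<comment> \<open>These are the coefficients of \<open>q^l * p\<close>, the entries leaving the
    window.\<close>
  define c where "c = (\<lambda>n. if l \<le> n then coeff p (n - l) else 0)"
  have step: "b (Suc n) = b n + coeff p (Suc n) - c (Suc n)" for n
    unfolding b_def c_def by (rule coeff_q_int_mult_Suc)
  obtain m where inc_Suc: "\<And>i. i < m \<Longrightarrow> coeff p i \<le> coeff p (Suc i)"
    and dec_Suc: "\<And>i. i \<ge> m \<Longrightarrow> coeff p (Suc i) \<le> coeff p i"
    using uni unfolding unimodal_seq_def by blast
  have inc: "coeff p i \<le> coeff p j" if "i \<le> j" "j \<le> m" for i j
    using that
  proof (induction j rule: dec_induct)
    case (step n)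
    then show ?case using inc_Suc[of n] by simp
  qed simp
  have dec: "coeff p j \<le> coeff p i" if "i \<le> j" "m \<le> i" for i j
    using that
  proof (induction j rule: dec_induct)
    case (step n)
    then show ?case using dec_Suc[of n] by simp
  qed simp
  show ?thesis
  proof (cases "\<exists>n. b (Suc n) < b n")
    case True
    \<comment> \<open>The first strict descent of \<open>b\<close> is the candidate peak.\<close>
    define N where "N = (LEAST n. b (Suc n) < b n)"
    have N: "b (Suc N) < b N"
      unfolding N_def using True by (rule LeastI_ex)
    have before: "b i \<le> b (Suc i)" if "i < N" for i
      using not_less_Least that unfolding N_def by fastforce
    have drop: "coeff p (Suc N) < c (Suc N)"
      using N step[of N] by simp
    \<comment> \<open>Otherwise \<open>c (Suc N)\<close> is the default 0, which cannot exceed a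
      nonnegative coefficient.\<close>
    then have lN: "l \<le> Suc N"
      using nonneg[of "Suc N"] by (auto simp: c_def split: if_splits)
    \<comment> \<open>If both ends of the window were on the rising side of \<open>p\<close>, the
      gained entry would be at least the lost one.\<close>
    have mN: "m < Suc N"
    proof (rule ccontr)
      assume "\<not> m < Suc N"
      then have "coeff p (Suc N - l) \<le> coeff p (Suc N)"
        by (intro inc) auto
      then show False
        using drop lN by (simp add: c_def)
    qed
    have after: "b (Suc i) \<le> b i" if "N \<le> i" for i
    proof -
      have "coeff p (Suc i) \<le> coeff p (Suc i - l)"
      proof (cases "m \<le> Suc i - l")
        case True
        then show ?thesis by (intro dec) auto
      next
        \<comment> \<open>The lost entry is still on the rising side and the gained one already on
          the falling side, so the inequality at \<open>N\<close> propagates to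
          \<open>i\<close>.\<close>
        case False
        have "coeff p (Suc i) \<le> coeff p (Suc N)"
          using that mN by (intro dec) auto
        also have "\<dots> \<le> coeff p (Suc N - l)"
          using drop lN by (simp add: c_def)
        also have "\<dots> \<le> coeff p (Suc i - l)"
          using that False by (intro inc) auto
        finally show ?thesis .
      qed
      then show ?thesis
        using step[of i] lN that by (simp add: c_def)
    qed
    show ?thesis
      unfolding unimodal_seq_def b_def[symmetric] using before after by blast
  next
    case False
    \<comment> \<open>Without a strict descent \<open>b\<close> rises throughout; past the degree it
      vanishes, so the degree serves as peak.\<close>
    have "0 \<le> b i" for i
      unfolding b_def coeff_q_int_mult by (intro sum_nonneg) (simp add: nonneg)
    moreover have "b (Suc i) = 0" if "i \<ge> degree (q_int l * p)" for i
      unfolding b_def using that by (intro coeff_eq_0) simp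
    ultimately show ?thesis
      unfolding unimodal_seq_def b_def[symmetric] using False
      by (intro exI[of _ "degree (q_int l * p)"]) (auto simp: not_less)
  qed
qed

lemma unimodal_pCons:
  assumes "unimodal_seq (coeff p)" "x \<le> coeff p 0"
  shows "unimodal_seq (coeff (pCons x p))"
proof -
  obtain m where "\<And>i. i < m \<Longrightarrow> coeff p i \<le> coeff p (Suc i)"
    "\<And>i. i \<ge> m \<Longrightarrow> coeff p (Suc i) \<le> coeff p i"
    using assms(1) unfolding unimodal_seq_def by blast
  then show ?thesis
    unfolding unimodal_seq_def using assms(2)
    by (intro exI[of _ "Suc m"]) (auto simp: coeff_pCons split: nat.split)
qed

lemma rect_compositions_0: "rect_compositions k l 0 = {[]}"
proof -
  have "\<kappa> = []" if "\<forall>x\<in>set \<kappa>. 1 \<le> x \<and> x \<le> l" "sum_list \<kappa> = 0" for \<kappa> :: "nat list"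
    using that by (cases \<kappa>) auto
  then show ?thesis by (auto simp: rect_compositions_def)
qed

text \<open>Split off the first part, written \<open>Suc i\<close> so that \<open>i\<close> runs
  over the exponents in \<open>q_int l\<close>; the remaining factor \<open>q\<close> becomes the
  shift from \<open>n\<close> to \<open>Suc n\<close>.\<close>

lemma rect_compositions_Suc:
  "rect_compositions (Suc k) l (Suc n) =
     (\<Union>i\<in>{i. i < l \<and> i \<le> n}. Cons (Suc i) ` rect_compositions k l (n - i))" (is "?L = ?R")
proof (rule set_eqI)
  fix \<kappa>
  show "\<kappa> \<in> ?L \<longleftrightarrow> \<kappa> \<in> ?R"
  proof (cases \<kappa>)
    case Nil
    then show ?thesis by (auto simp: rect_compositions_def)
  next
    case (Cons x xs)
    then have "\<kappa> \<in> ?R \<longleftrightarrow>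
        (\<exists>i. x = Suc i \<and> i < l \<and> i \<le> n \<and> xs \<in> rect_compositions k l (n - i))"
      by auto
    then show ?thesis using Cons by (cases x) (auto simp: rect_compositions_def)
  qed
qed

lemma comp_count_0: "comp_count k l 0 = 1"
  by (simp add: comp_count_def rect_compositions_0)

lemma comp_count_Suc:
  "comp_count (Suc k) l (Suc n) = (\<Sum>i<l. if i \<le> n then comp_count k l (n - i) else 0)"
proof -
  have "comp_count (Suc k) l (Suc n) = (\<Sum>i\<in>{i. i < l \<and> i \<le> n}. comp_count k l (n - i))"
    unfolding comp_count_def rect_compositions_Suc
    \<comment> \<open>Distinct first parts make the images disjoint, and prepending a fixed part is
      injective.\<close>
    by (subst card_UN_disjoint) (auto simp: finite_rect_compositions card_image)
  also have "{i. i < l \<and> i \<le> n} = {i \<in> {..<l}. i \<le> n}"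
    by auto
  finally show ?thesis
    by (simp only: sum.inter_filter[OF finite_lessThan])
qed

text \<open>Including \<open>k = 0\<close> lets the unimodality induction start from the constant
  polynomial 1.\<close>

lemma comp_poly_Suc: "comp_poly (Suc k) l = pCons 1 (q_int l * comp_poly k l)"
proof (rule poly_eqI)
  fix n
  show "coeff (comp_poly (Suc k) l) n = coeff (pCons 1 (q_int l * comp_poly k l)) n"
    by (cases n)
      (auto simp: coeff_comp_poly comp_count_0 comp_count_Suc coeff_q_int_mult intro!: sum.cong)
qed

lemma unimodal_comp_poly:
  assumes "l \<ge> 1"
  shows "unimodal_seq (coeff (comp_poly k l))"
proof (induction k)
  case 0
  have "comp_poly 0 l = 1"
    by (simp add: comp_poly_def comp_count_0)
  then show ?case
    unfolding unimodal_seq_def by (intro exI[of _ 0]) simp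
next
  case (Suc k)
  \<comment> \<open>Prepending 1 requires a constant coefficient of at least 1; here
    \<open>l \<ge> 1\<close> supplies the term \<open>i = 0\<close>.\<close>
  have "coeff (q_int l * comp_poly k l) 0 = (\<Sum>i<l. if i = 0 then 1 else 0)"
    by (auto simp: coeff_q_int_mult coeff_comp_poly comp_count_0 intro!: sum.cong)
  also have "\<dots> = 1"
    using assms by simp
  finally show ?case
    unfolding comp_poly_Suc
    by (intro unimodal_pCons unimodal_q_int_mult Suc) (simp_all add: coeff_comp_poly)
qed

theorem theorem2p2:
  fixes k l :: nat
  assumes "k \<ge> 1" and "l \<ge> 1"
  shows "(k \<ge> 2 \<longrightarrow> comp_poly k l = 1 + monom 1 1 * q_int l * comp_poly (k - 1) l) \<and>
         (unimodal_poly (comp_poly k l) \<and> unimodal_upto (k * l) (comp_count k l))"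
proof (intro conjI impI)
  obtain k' where "k = Suc k'"
    using assms(1) by (cases k) auto
  then show "comp_poly k l = 1 + monom 1 1 * q_int l * comp_poly (k - 1) l"
    by (simp add: comp_poly_Suc monom_Suc one_pCons)
next
  have uni: "unimodal_upto r (coeff (comp_poly k l))" for r
    by (intro unimodal_upto_of_unimodal_seq unimodal_comp_poly assms(2))
      (simp add: coeff_comp_poly)
  then show "unimodal_poly (comp_poly k l)"
    by (simp add: unimodal_poly_def)
  show "unimodal_upto (k * l) (comp_count k l)"
    using uni unfolding coeff_comp_poly unimodal_upto_of_nat .
qed

end
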